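(* Let $A_m$ be the number of domino tilings of the $3\times 2m$ rectangular grid, and let $L_3(2n,2n)$ be the number of domino tilings of the right-angle (L-shaped) grid composed of a vertical $3\times 2n$ rectangle and a horizontal $3\times 2n$ rectangle. Then for every integer $n\ge 2$, $$L_3(2n,2n)=A_{2n}.$$
   Context: Identify unit squares with points $(i,j)\in\mathbb{Z}^2$. A grid is a finite set of unit squares. A domino is a pair of unit squares sharing an edge, i.e. $\{(i,j),(i+1,j)\}$ or $\{(i,j),(i,j+1)\}$. A domino tiling of a grid is a partition of its set of squares into dominoes; tilings are counted as distinct partitions (no identification under symmetry). $A_m$ ($m\ge 1$) is the number of domino tilings of $\{1,\dots,2m\}\times\{1,2,3\}$. For integers $n\ge 2$, $k\ge 1$, $L_3(2n,2k)$ is the number of domino tilings of the right-angle grid $$\bigl(\{1,2,3\}\times\{1,\dots,2n\}\bigr)\ \cup\ \bigl(\{4,\dots,2k+3\}\times\{1,2,3\}\bigr),$$ composed of a vertical $3\times 2n$ rectangle and a horizontal $3\times 2k$ rectangle attached to the lowest three rows of its right side; $L_3(2n,2n)$ is the case $k=n$. *)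

theory Defs
  imports Main "HOL-Library.Disjoint_Sets"
begin

type_synonym square = "int \<times> int"

definition is_domino :: "square set \<Rightarrow> bool" where
  "is_domino d \<longleftrightarrow> (\<exists>i j. d = {(i, j), (i + 1, j)} \<or> d = {(i, j), (i, j + 1)})"

definition domino_tilings :: "square set \<Rightarrow> square set set set" where
  "domino_tilings G = {T. partition_on G T \<and> (\<forall>d\<in>T. is_domino d)}"

text \<open>Only finite grids \<open>G\<close> are intended; every finite grid has finitely many tilings, so
  \<open>card\<close> is the true count.\<close>

definition num_tilings :: "square set \<Rightarrow> nat" where
  "num_tilings G = card (domino_tilings G)"

definition A :: "nat \<Rightarrow> nat" where
  "A m = num_tilings ({1..2 * int m} \<times> {1..3})"

text \<open>The arguments of \<open>L\<^sub>3(p, q)\<close> are the actual side lengths: \<open>p\<close> is the height of the vertical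
  rectangle, \<open>q\<close> the width of the horizontal one. The L-shape requires \<open>p \<ge> 3\<close>.\<close>

definition L_grid :: "nat \<Rightarrow> nat \<Rightarrow> square set" where
  "L_grid p q = ({1..3} \<times> {1..int p}) \<union> ({4..int q + 3} \<times> {1..3})"

definition L3 :: "nat \<Rightarrow> nat \<Rightarrow> nat" where
  "L3 p q = num_tilings (L_grid p q)"

end

theory Submission
  imports Defs
begin

text \<open>
  The even-width arm is peeled off two columns at a time. For a region \<open>Y\<close> whose rightmost column
  \<open>m\<close> contains the squares in rows 1, 2 and 3, let \<open>F(Y)\<close> be the number of tilings of \<open>Y\<close>, and let
  \<open>H(Y)\<close> be the sum of the two numbers of tilings that remain after deleting from column \<open>m\<close> the
  squares in rows 1 and 2, respectively in rows 2 and 3. If \<open>Y'\<close> is \<open>Y\<close> with two more columns of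
  these three rows, then
  \<open>H(Y') = 2 F(Y) + H(Y)\<close> and \<open>F(Y') = F(Y) + H(Y')\<close>
  (\<open>deficit_widen\<close>, \<open>num_tilings_widen\<close>).
  Hence the number of tilings of a region with an arm of length \<open>2k\<close> depends only on \<open>k\<close> and the pair
  \<open>(F, H)\<close> of the region that carries the arm.

  The \<open>3 \<times> 4n\<close> rectangle and the L-shape both arise by attaching an arm of length \<open>2n\<close> to a
  \<open>3 \<times> 2n\<close> rectangle, in the first case at its short side, in the second case at the end of its
  long side. The two values of \<open>F\<close> agree since the carriers are congruent. The two values of \<open>H\<close>
  agree as well, although the deleted pairs of squares are not congruent (\<open>corner_deficit\<close>): writing
  \<open>Y\<close> for the rectangle shortened by two columns, both are equal to \<open>2 F(Y) + H(Y)\<close>.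
\<close>

section \<open>Counting tilings by the domino on a given square\<close>

definition nbrs :: "square \<Rightarrow> square set" where
  "nbrs c = (case c of (x, y) \<Rightarrow> {(x + 1, y), (x - 1, y), (x, y + 1), (x, y - 1)})"

lemma is_domino_iff_nbrs: "c \<in> d \<Longrightarrow> is_domino d \<longleftrightarrow> (\<exists>e\<in>nbrs c. d = {c, e})"
proof (cases c)
  case (Pair x y)
  assume "c \<in> d"
  show ?thesis
  proof
    assume "is_domino d"
    then obtain i j where ij: "d = {(i, j), (i + 1, j)} \<or> d = {(i, j), (i, j + 1)}"
      unfolding is_domino_def by blast
    then obtain q where q: "d = {(i, j), q}" "q = (i + 1, j) \<or> q = (i, j + 1)"
      by blast
    from q(2) have nb: "q \<in> nbrs (i, j)" "(i, j) \<in> nbrs q"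
      by (auto simp: nbrs_def)
    from q(1) \<open>c \<in> d\<close> consider "c = (i, j)" | "c = q" by blast
    then show "\<exists>e\<in>nbrs c. d = {c, e}"
    proof cases
      case 1
      then show ?thesis using nb(1) q(1) by blast
    next
      case 2
      then show ?thesis using nb(2) q(1) by blast
    qed
  next
    assume "\<exists>e\<in>nbrs c. d = {c, e}"
    then obtain e where e: "e \<in> nbrs c" "d = {c, e}" by blast
    then consider "e = (x + 1, y)" | "e = (x - 1, y)" | "e = (x, y + 1)" | "e = (x, y - 1)"
      by (auto simp: nbrs_def Pair)
    then show "is_domino d"
    proof cases
      case 1
      then have "d = {(x, y), (x + 1, y)}" using e Pair by simp
      then show ?thesis unfolding is_domino_def by blast
    next
      case 2
      then have "d = {(x - 1, y), (x - 1 + 1, y)}" using e Pair by auto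
      then show ?thesis unfolding is_domino_def by blast
    next
      case 3
      then have "d = {(x, y), (x, y + 1)}" using e Pair by simp
      then show ?thesis unfolding is_domino_def by blast
    next
      case 4
      then have "d = {(x, y - 1), (x, y - 1 + 1)}" using e Pair by auto
      then show ?thesis unfolding is_domino_def by blast
    qed
  qed
qed

lemma finite_nbrs: "finite (nbrs c)"
  by (cases c) (simp add: nbrs_def)

lemma not_in_nbrs_self: "c \<notin> nbrs c"
  by (cases c) (simp add: nbrs_def)

lemma is_domino_nonempty: "is_domino d \<Longrightarrow> d \<noteq> {}"
  by (auto simp: is_domino_def)

lemma finite_domino_tilings: "finite G \<Longrightarrow> finite (domino_tilings G)"
  by (rule finite_subset[of _ "Pow (Pow G)"]) (auto simp: domino_tilings_def partition_on_def)

lemma card_tilings_containing: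
  assumes d: "is_domino d" and dG: "d \<subseteq> G"
  shows "card {T \<in> domino_tilings G. d \<in> T} = num_tilings (G - d)"
proof -
  have ne: "d \<noteq> {}" using d by (rule is_domino_nonempty)
  have notin: "d \<notin> T" if "T \<in> domino_tilings (G - d)" for T
    using that ne by (auto simp: domino_tilings_def partition_on_def)
  have ins: "insert d T \<in> domino_tilings G" if "T \<in> domino_tilings (G - d)" for T
  proof -
    have p: "partition_on (G - d) T" using that by (simp add: domino_tilings_def)
    then have "disjnt d (\<Union> T)" by (auto simp: partition_on_def disjnt_def)
    then have "partition_on G (insert d T)" using p ne dG by (simp add: partition_on_insert)
    then show ?thesis using that d by (simp add: domino_tilings_def)
  qed
  have rem: "T - {d} \<in> domino_tilings (G - d)" if "T \<in> domino_tilings G" "d \<in> T" for T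
  proof -
    have p: "partition_on G T" using that by (simp add: domino_tilings_def)
    have dj: "\<And>e. e \<in> T \<Longrightarrow> e \<noteq> d \<Longrightarrow> e \<inter> d = {}"
      using partition_onD2[OF p] that(2) by (auto simp: disjoint_def)
    have "partition_on (G - d) (T - {d})"
    proof (rule partition_onI)
      show "\<Union> (T - {d}) = G - d"
        using partition_onD1[OF p] dj that(2) by blast
      show "\<And>p q. p \<in> T - {d} \<Longrightarrow> q \<in> T - {d} \<Longrightarrow> p \<noteq> q \<Longrightarrow> disjnt p q"
        using partition_onD2[OF p] by (auto simp: disjoint_def disjnt_def)
      show "{} \<notin> T - {d}" using partition_onD3[OF p] by auto
    qed
    then show ?thesis using that by (simp add: domino_tilings_def)
  qed
  have "bij_betw (insert d) (domino_tilings (G - d)) {T \<in> domino_tilings G. d \<in> T}"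
    by (rule bij_betwI[where g = "\<lambda>T. T - {d}"]) (use ins rem notin in auto)
  then show ?thesis by (simp add: num_tilings_def bij_betw_same_card)
qed

text \<open>The square \<open>c\<close> is covered by exactly one domino, which also covers one neighbour \<open>e\<close>.\<close>

lemma num_tilings_branch:
  assumes fin: "finite G" and c: "c \<in> G"
  shows "num_tilings G = (\<Sum>e\<in>nbrs c \<inter> G. num_tilings (G - {c, e}))"
proof -
  let ?P = "\<lambda>e. {T \<in> domino_tilings G. {c, e} \<in> T}"
  have cover: "domino_tilings G = (\<Union>e\<in>nbrs c \<inter> G. ?P e)"
  proof (intro subset_antisym subsetI)
    fix T assume T: "T \<in> domino_tilings G"
    then have U: "\<Union> T = G" by (simp add: domino_tilings_def partition_on_def)
    with c obtain d where d: "d \<in> T" "c \<in> d" by blast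
    then have "is_domino d" using T by (simp add: domino_tilings_def)
    with d obtain e where "e \<in> nbrs c" "d = {c, e}" using is_domino_iff_nbrs by blast
    then show "T \<in> (\<Union>e\<in>nbrs c \<inter> G. ?P e)" using T d U by blast
  qed auto
  have disj: "?P e \<inter> ?P f = {}" if "e \<in> nbrs c" "f \<in> nbrs c" "e \<noteq> f" for e f
  proof -
    have "{c, e} \<noteq> {c, f}" using that not_in_nbrs_self by (auto simp: doubleton_eq_iff)
    then have "False" if "partition_on G T" "{c, e} \<in> T" "{c, f} \<in> T" for T
      using disjointD[OF partition_onD2[OF that(1)] that(2,3)] by blast
    then show ?thesis by (auto simp: domino_tilings_def)
  qed
  have "num_tilings G = (\<Sum>e\<in>nbrs c \<inter> G. card (?P e))"
    unfolding num_tilings_def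
    by (subst cover, rule card_UN_disjoint)
      (use finite_nbrs finite_domino_tilings[OF fin] disj in auto)
  also have "\<dots> = (\<Sum>e\<in>nbrs c \<inter> G. num_tilings (G - {c, e}))"
  proof (rule sum.cong)
    fix e assume e: "e \<in> nbrs c \<inter> G"
    then have "is_domino {c, e}" using is_domino_iff_nbrs[of c "{c, e}"] by auto
    then show "card (?P e) = num_tilings (G - {c, e})"
      using e c by (intro card_tilings_containing) auto
  qed simp
  finally show ?thesis .
qed

lemma num_tilings_forced:
  assumes "finite G" "c \<in> G" "nbrs c \<inter> G = {e}" "G - {c, e} = G'"
  shows "num_tilings G = num_tilings G'"
  using num_tilings_branch[OF assms(1,2)] assms(3,4) by simp

lemma num_tilings_two_choices:
  assumes "finite G" "c \<in> G" "nbrs c \<inter> G = {e, f}" "e \<noteq> f"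
    "G - {c, e} = G1" "G - {c, f} = G2"
  shows "num_tilings G = num_tilings G1 + num_tilings G2"
  using num_tilings_branch[OF assms(1,2)] assms(3-) by simp

section \<open>Congruence invariance\<close>

lemma num_tilings_image:
  assumes inj: "inj f" and dom: "\<And>d. is_domino (f ` d) \<longleftrightarrow> is_domino d"
  shows "num_tilings (f ` G) = num_tilings G"
proof -
  have inj2: "inj ((`) ((`) f))"
    using inj by (simp add: inj_def inj_image_eq_iff)
  have tile: "(`) f ` T \<in> domino_tilings (f ` G) \<longleftrightarrow> T \<in> domino_tilings G" for T
  proof -
    have "partition_on (f ` G) ((`) f ` T) \<longleftrightarrow> partition_on G T"
      unfolding partition_on_def disjoint_def
      using inj by (auto simp: image_Union[symmetric] image_Int[symmetric] inj_image_eq_iff)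
    then show ?thesis by (simp add: domino_tilings_def dom)
  qed
  have "domino_tilings (f ` G) = (`) ((`) f) ` domino_tilings G"
  proof (intro subset_antisym subsetI)
    fix S assume S: "S \<in> domino_tilings (f ` G)"
    then have "\<Union> S = f ` G" by (simp add: domino_tilings_def partition_on_def)
    then have "f ` inv f ` d = d" if "d \<in> S" for d
      using that by (intro image_inv_into_cancel[OF refl]) blast
    then have "S = (`) f ` ((`) (inv f) ` S)"
      by (simp add: image_image)
    then show "S \<in> (`) ((`) f) ` domino_tilings G" using S tile by (metis image_eqI)
  qed (use tile in auto)
  then show ?thesis
    using inj2 by (simp add: num_tilings_def card_image inj_on_subset)
qed

text \<open>The orientation is chosen so that the bottom end of a vertical strip becomes the right end of a
  horizontal one, its right side becoming the top row; the offset \<open>s\<close> undoes the displacement.\<close>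

definition quarter_turn :: "int \<Rightarrow> square \<Rightarrow> square" where
  "quarter_turn s = (\<lambda>(x, y). (s - y, x))"

lemma inj_quarter_turn: "inj (quarter_turn s)"
  by (auto simp: inj_def quarter_turn_def)

lemma nbrs_quarter_turn: "nbrs (quarter_turn s c) = quarter_turn s ` nbrs c"
  by (cases c) (auto simp: nbrs_def quarter_turn_def)

lemma is_domino_quarter_turn: "is_domino (quarter_turn s ` d) \<longleftrightarrow> is_domino d"
proof (cases "d = {}")
  case True
  then show ?thesis by (simp add: is_domino_def)
next
  case False
  then obtain c where c: "c \<in> d" by blast
  have "is_domino (quarter_turn s ` d) \<longleftrightarrow>
      (\<exists>e\<in>nbrs c. quarter_turn s ` d = quarter_turn s ` {c, e})"
    using is_domino_iff_nbrs[of "quarter_turn s c"] c by (simp add: nbrs_quarter_turn)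
  also have "\<dots> \<longleftrightarrow> is_domino d"
    using is_domino_iff_nbrs[OF c] by (simp only: inj_image_eq_iff[OF inj_quarter_turn])
  finally show ?thesis .
qed

lemmas num_tilings_quarter_turn =
  num_tilings_image[OF inj_quarter_turn is_domino_quarter_turn]

section \<open>Attaching two columns of height three\<close>

definition full_end :: "square set \<Rightarrow> int \<Rightarrow> bool" where
  "full_end Y m \<longleftrightarrow> finite Y \<and> (\<forall>x y. (x, y) \<in> Y \<longrightarrow> x \<le> m) \<and> (\<forall>y\<in>{1, 2, 3}. (m, y) \<in> Y)"

definition widen :: "square set \<Rightarrow> int \<Rightarrow> square set" where
  "widen Y m = Y \<union> {m + 1, m + 2} \<times> {1, 2, 3}"

text \<open>This is the quantity \<open>H(Y)\<close> of the introduction, that is, the number of tilings of \<open>Y\<close> with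
  a vertical domino inside rows 1 to 3 of column \<open>m\<close>.\<close>

definition deficit :: "square set \<Rightarrow> int \<Rightarrow> nat" where
  "deficit Y m = num_tilings (Y - {(m, 1), (m, 2)}) + num_tilings (Y - {(m, 3), (m, 2)})"

lemma full_end_widen: "full_end Y m \<Longrightarrow> full_end (widen Y m) (m + 2)"
  by (force simp: full_end_def widen_def)

text \<open>The row \<open>a\<close> is the bottom or the top row: either the two protruding squares form a domino, or
  both are matched to the left.\<close>

lemma num_tilings_half_column:
  assumes Y: "full_end Y m" and a: "a = 1 \<or> a = 3"
  shows "num_tilings (Y \<union> {(m + 1, a), (m + 1, 2)}) = num_tilings Y + num_tilings (Y - {(m, a), (m, 2)})"
proof -
  have le: "\<And>x y. (x, y) \<in> Y \<Longrightarrow> x \<le> m" and fin: "finite Y"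
    and m: "(m, 1) \<in> Y" "(m, 2) \<in> Y" "(m, 3) \<in> Y"
    using Y by (auto simp: full_end_def)
  have out: "\<And>x y. m < x \<Longrightarrow> (x, y) \<notin> Y" using le by force
  have "num_tilings (Y \<union> {(m + 1, a), (m + 1, 2)})
      = num_tilings Y + num_tilings (insert (m + 1, 2) (Y - {(m, a)}))"
    by (rule num_tilings_two_choices[where c = "(m + 1, a)" and e = "(m + 1, 2)" and f = "(m, a)"])
      (use a fin m out in \<open>auto simp: nbrs_def\<close>)
  also have "num_tilings (insert (m + 1, 2) (Y - {(m, a)})) = num_tilings (Y - {(m, a), (m, 2)})"
    by (rule num_tilings_forced[where c = "(m + 1, 2)" and e = "(m, 2)"])
      (use a fin m out in \<open>auto simp: nbrs_def\<close>)
  finally show ?thesis .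
qed

text \<open>The remaining square of the last column can only be matched to the left.\<close>

lemma num_tilings_widen_minus:
  assumes Y: "full_end Y m" and a: "a = 1 \<or> a = 3"
  shows "num_tilings (widen Y m - {(m + 2, a), (m + 2, 2)})
    = num_tilings (Y \<union> {(m + 1, a), (m + 1, 2)})"
proof -
  have le: "\<And>x y. (x, y) \<in> Y \<Longrightarrow> x \<le> m" and fin: "finite Y"
    using Y by (auto simp: full_end_def)
  have out: "\<And>x y. m < x \<Longrightarrow> (x, y) \<notin> Y" using le by force
  show ?thesis
    by (rule num_tilings_forced[where c = "(m + 2, 4 - a)" and e = "(m + 1, 4 - a)"])
      (use a fin out in \<open>auto simp: nbrs_def widen_def\<close>)
qed

lemma deficit_widen:
  assumes "full_end Y m"
  shows "deficit (widen Y m) (m + 2) = 2 * num_tilings Y + deficit Y m"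
  using num_tilings_widen_minus[OF assms] num_tilings_half_column[OF assms]
  by (simp add: deficit_def)

text \<open>In the last column, the lower two squares form a domino, or the upper two do, or all three
  squares are matched to the left.\<close>

lemma num_tilings_widen:
  assumes Y: "full_end Y m"
  shows "num_tilings (widen Y m) = num_tilings Y + deficit (widen Y m) (m + 2)"
proof -
  have le: "\<And>x y. (x, y) \<in> Y \<Longrightarrow> x \<le> m" and fin: "finite Y"
    using Y by (auto simp: full_end_def)
  have out: "\<And>x y. m < x \<Longrightarrow> (x, y) \<notin> Y" using le by force
  let ?W = "Y \<union> {(m + 1, 2), (m + 1, 3), (m + 2, 2), (m + 2, 3)}"
  have "num_tilings (widen Y m)
      = num_tilings (widen Y m - {(m + 2, 1), (m + 2, 2)}) + num_tilings ?W"
    by (rule num_tilings_two_choices[where c = "(m + 2, 1)" and e = "(m + 2, 2)" and f = "(m + 1, 1)"])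
      (use fin out in \<open>auto simp: nbrs_def widen_def\<close>)
  also have "num_tilings ?W
      = num_tilings (Y \<union> {(m + 1, 3), (m + 1, 2)}) + num_tilings (Y \<union> {(m + 1, 3), (m + 2, 3)})"
    by (rule num_tilings_two_choices[where c = "(m + 2, 2)" and e = "(m + 2, 3)" and f = "(m + 1, 2)"])
      (use fin out in \<open>auto simp: nbrs_def\<close>)
  also have "num_tilings (Y \<union> {(m + 1, 3), (m + 2, 3)}) = num_tilings Y"
    by (rule num_tilings_forced[where c = "(m + 2, 3)" and e = "(m + 1, 3)"])
      (use fin out in \<open>auto simp: nbrs_def\<close>)
  finally show ?thesis
    using num_tilings_widen_minus[OF Y, of 3] by (simp add: deficit_def)
qed

section \<open>The corner of the L-shape\<close>

lemma num_tilings_minus_end_pair: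
  assumes Y: "full_end Y m"
  shows "num_tilings (widen Y m - {(m + 2, 3), (m + 1, 3)})
    = 2 * num_tilings Y + num_tilings (Y - {(m, 1), (m, 2)})"
proof -
  have le: "\<And>x y. (x, y) \<in> Y \<Longrightarrow> x \<le> m" and fin: "finite Y"
    using Y by (auto simp: full_end_def)
  have out: "\<And>x y. m < x \<Longrightarrow> (x, y) \<notin> Y" using le by force
  have "num_tilings (widen Y m - {(m + 2, 3), (m + 1, 3)})
      = num_tilings (Y \<union> {(m + 1, 1), (m + 1, 2)}) + num_tilings (Y \<union> {(m + 1, 2), (m + 2, 2)})"
    by (rule num_tilings_two_choices[where c = "(m + 2, 1)" and e = "(m + 2, 2)" and f = "(m + 1, 1)"])
      (use fin out in \<open>auto simp: nbrs_def widen_def\<close>)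
  also have "num_tilings (Y \<union> {(m + 1, 2), (m + 2, 2)}) = num_tilings Y"
    by (rule num_tilings_forced[where c = "(m + 2, 2)" and e = "(m + 1, 2)"])
      (use fin out in \<open>auto simp: nbrs_def\<close>)
  finally show ?thesis
    using num_tilings_half_column[OF Y, of 1] by simp
qed

text \<open>The two deleted squares isolate the top square of the last column from its left neighbour, and
  all dominoes in the last two columns are then forced, one after the other.\<close>

lemma num_tilings_minus_inner_pair:
  assumes Y: "full_end Y m"
  shows "num_tilings (widen Y m - {(m + 1, 3), (m, 3)}) = num_tilings (Y - {(m, 3), (m, 2)})"
proof -
  have le: "\<And>x y. (x, y) \<in> Y \<Longrightarrow> x \<le> m" and fin: "finite Y"
    and m: "(m, 1) \<in> Y" "(m, 2) \<in> Y" "(m, 3) \<in> Y"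
    using Y by (auto simp: full_end_def)
  have out: "\<And>x y. m < x \<Longrightarrow> (x, y) \<notin> Y" using le by force
  have "num_tilings (widen Y m - {(m + 1, 3), (m, 3)})
      = num_tilings ((Y - {(m, 3)}) \<union> {(m + 1, 1), (m + 1, 2), (m + 2, 1)})"
    by (rule num_tilings_forced[where c = "(m + 2, 3)" and e = "(m + 2, 2)"])
      (use fin m out in \<open>auto simp: nbrs_def widen_def\<close>)
  also have "\<dots> = num_tilings ((Y - {(m, 3)}) \<union> {(m + 1, 2)})"
    by (rule num_tilings_forced[where c = "(m + 2, 1)" and e = "(m + 1, 1)"])
      (use fin m out in \<open>auto simp: nbrs_def\<close>)
  also have "\<dots> = num_tilings (Y - {(m, 3), (m, 2)})"
    by (rule num_tilings_forced[where c = "(m + 1, 2)" and e = "(m, 2)"])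
      (use fin m out in \<open>auto simp: nbrs_def\<close>)
  finally show ?thesis .
qed

text \<open>Dominoes that cross into the arm of the L-shape take two adjacent squares from the last three
  squares of a long side of the strip, here its top row; in the rectangle they take them from the
  short side. With \<open>F\<close> the number of tilings of \<open>Y\<close> and \<open>H\<^sub>1 + H\<^sub>2\<close> the deficit of \<open>Y\<close>, the two
  long-side counts are \<open>2 F + H\<^sub>1\<close> and \<open>H\<^sub>2\<close>, the two short-side counts are \<open>F + H\<^sub>1\<close> and
  \<open>F + H\<^sub>2\<close>: in general only their sums agree.\<close>

lemma corner_deficit:
  assumes "full_end Y m"
  shows "num_tilings (widen Y m - {(m + 2, 3), (m + 1, 3)})
    + num_tilings (widen Y m - {(m + 1, 3), (m, 3)}) = deficit (widen Y m) (m + 2)"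
  using num_tilings_minus_end_pair[OF assms] num_tilings_minus_inner_pair[OF assms]
    deficit_widen[OF assms]
  by (simp add: deficit_def)

section \<open>Comparing the L-shape with the rectangle\<close>

definition strip :: "nat \<Rightarrow> square set" where
  "strip m = {1..2 * int m} \<times> {1..3}"

lemma int_1_3: "{1..3::int} = {1, 2, 3}"
  by auto

lemma full_end_strip: "m \<ge> 1 \<Longrightarrow> full_end (strip m) (2 * int m)"
  by (auto simp: full_end_def strip_def)

lemma strip_Suc: "strip (Suc m) = widen (strip m) (2 * int m)"
  unfolding strip_def widen_def int_1_3 by auto

lemma L_grid_Suc: "L_grid p (2 * Suc k) = widen (L_grid p (2 * k)) (2 * int k + 3)"
proof -
  have "{4..int (2 * Suc k) + 3}
      = {4..int (2 * k) + 3} \<union> {2 * int k + 3 + 1, 2 * int k + 3 + 2}"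
    by auto
  then show ?thesis
    unfolding L_grid_def widen_def int_1_3 by (simp only: Sigma_Un_distrib1 Un_assoc)
qed

lemma full_end_L_grid: "p \<ge> 3 \<Longrightarrow> full_end (L_grid p (2 * k)) (2 * int k + 3)"
  by (cases "k = 0") (auto simp: full_end_def L_grid_def)

lemma quarter_turn_L_grid:
  "quarter_turn (2 * int n + 1) ` L_grid (2 * n) 0 = strip n"
proof -
  have "\<exists>c\<in>L_grid (2 * n) 0. quarter_turn (2 * int n + 1) c = (x, y)" if "(x, y) \<in> strip n" for x y
    using that by (intro bexI[of _ "(y, 2 * int n + 1 - x)"])
      (auto simp: quarter_turn_def L_grid_def strip_def)
  then show ?thesis
    by (force simp: quarter_turn_def L_grid_def strip_def image_iff)
qed

lemma L_grid_0:
  assumes n: "n \<ge> 2"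
  shows "num_tilings (L_grid (2 * n) 0) = num_tilings (strip n)"
    and "deficit (L_grid (2 * n) 0) 3 = deficit (strip n) (2 * int n)"
proof -
  let ?r = "quarter_turn (2 * int n + 1)"
  let ?m = "2 * int (n - 1)"
  have fe: "full_end (strip (n - 1)) ?m" using n by (intro full_end_strip) auto
  have st: "strip n = widen (strip (n - 1)) ?m" using n strip_Suc[of "n - 1"] by simp
  have m: "?m + 2 = 2 * int n" using n by simp
  show "num_tilings (L_grid (2 * n) 0) = num_tilings (strip n)"
    using num_tilings_quarter_turn[of "2 * int n + 1" "L_grid (2 * n) 0"]
    by (simp add: quarter_turn_L_grid)
  have turn: "num_tilings (L_grid (2 * n) 0 - S) = num_tilings (strip n - ?r ` S)" for S
    using num_tilings_quarter_turn[of "2 * int n + 1" "L_grid (2 * n) 0 - S"]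
    by (simp add: image_set_diff[OF inj_quarter_turn] quarter_turn_L_grid)
  (* The three squares along which the arm is attached become the last three squares of the top row. *)
  have "?r ` {(3, 1), (3, 2)} = {(?m + 2, 3), (?m + 1, 3)}"
    "?r ` {(3, 3), (3, 2)} = {(?m + 1, 3), (?m, 3)}"
    using n by (auto simp: quarter_turn_def)
  then have "deficit (L_grid (2 * n) 0) 3
      = num_tilings (strip n - {(?m + 2, 3), (?m + 1, 3)})
        + num_tilings (strip n - {(?m + 1, 3), (?m, 3)})"
    by (simp only: deficit_def turn)
  also have "\<dots> = deficit (strip n) (2 * int n)"
    using corner_deficit[OF fe] by (simp only: st[symmetric] m)
  finally show "deficit (L_grid (2 * n) 0) 3 = deficit (strip n) (2 * int n)" .
qed

text \<open>The deficits are part of the claim because the recurrence couples them with the tiling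
  numbers.\<close>

lemma L_grid_strip:
  assumes n: "n \<ge> 2"
  shows "num_tilings (L_grid (2 * n) (2 * k)) = num_tilings (strip (n + k)) \<and>
    deficit (L_grid (2 * n) (2 * k)) (2 * int k + 3) = deficit (strip (n + k)) (2 * int (n + k))"
proof (induction k)
  case 0
  then show ?case using L_grid_0[OF n] by simp
next
  case (Suc k)
  let ?L = "L_grid (2 * n) (2 * k)" and ?S = "strip (n + k)"
  have L: "full_end ?L (2 * int k + 3)" using n by (intro full_end_L_grid) auto
  have S: "full_end ?S (2 * int (n + k))" using n by (intro full_end_strip) auto
  have eqs: "L_grid (2 * n) (2 * Suc k) = widen ?L (2 * int k + 3)"
    "strip (n + Suc k) = widen ?S (2 * int (n + k))"
    "2 * int (Suc k) + 3 = (2 * int k + 3) + 2"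
    "2 * int (n + Suc k) = 2 * int (n + k) + 2"
    using L_grid_Suc strip_Suc[of "n + k"] by auto
  have "deficit (widen ?L (2 * int k + 3)) (2 * int k + 3 + 2)
      = deficit (widen ?S (2 * int (n + k))) (2 * int (n + k) + 2)"
    by (simp only: deficit_widen[OF L] deficit_widen[OF S] Suc.IH)
  then show ?case
    by (simp only: eqs num_tilings_widen[OF L] num_tilings_widen[OF S] Suc.IH)
qed

theorem theorem2p1:
  fixes n :: nat
  assumes "n \<ge> 2"
  shows "L3 (2 * n) (2 * n) = A (2 * n)"
proof -
  have "num_tilings (L_grid (2 * n) (2 * n)) = num_tilings (strip (2 * n))"
    using L_grid_strip[OF assms, of n] by (simp only: mult_2[of n, symmetric])
  then show ?thesis
    by (simp only: L3_def A_def strip_def)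
qed

end
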